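(* For every integer $n \ge 2$, the equation $$x_1 - 2x_2 + 4x_3 - \cdots + (-1)^{n-1} 2^{n-1} x_n = 0, \quad\text{i.e.}\quad \sum_{i=1}^{n} (-2)^{i-1} x_i = 0,$$ in the $n$ variables $x_1, \dots, x_n$ is $(n-1)$-regular but not $n$-regular.
   Context: $\mathbb{N}$ denotes the set of positive integers. For a positive integer $r$, an $r$-coloring of the positive integers is any function $C : \mathbb{N} \to \{1, \dots, r\}$. A linear homogeneous equation $a_1 x_1 + \cdots + a_n x_n = 0$ (with all $a_i$ nonzero integers) is called $r$-regular if for every $r$-coloring $C$ of the positive integers there is a monochromatic solution, i.e. positive integers $x_1, \dots, x_n$ (not necessarily distinct) satisfying the equation with $C(x_1) = \cdots = C(x_n)$. *)

theory Defs
  imports Main "HOL-Library.FuncSet"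
begin

text \<open>The positive integers are the set \<open>{1..}\<close> of type \<open>nat set\<close>; the value of a
  coloring at 0 is unconstrained and is never used.\<close>

definition coloring :: "nat \<Rightarrow> (nat \<Rightarrow> nat) \<Rightarrow> bool" where
  "coloring r C \<longleftrightarrow> C \<in> {1..} \<rightarrow> {1..r}"

definition monochromatic_solution ::
    "(nat \<Rightarrow> nat) \<Rightarrow> nat \<Rightarrow> (nat \<Rightarrow> int) \<Rightarrow> (nat \<Rightarrow> nat) \<Rightarrow> bool" where
  "monochromatic_solution C n a x \<longleftrightarrow>
     (\<forall>i\<in>{1..n}. x i \<ge> 1) \<and>
     (\<Sum>i=1..n. a i * int (x i)) = 0 \<and>
     (\<forall>i\<in>{1..n}. \<forall>j\<in>{1..n}. C (x i) = C (x j))"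

text \<open>\<open>regular r n a\<close>: the equation \<open>a 1 * x 1 + \<dots> + a n * x n = 0\<close> is \<open>r\<close>-regular.
  The notion is meant for \<open>r \<ge> 1\<close> and nonzero coefficients \<open>a 1, \<dots>, a n\<close>.\<close>

definition regular :: "nat \<Rightarrow> nat \<Rightarrow> (nat \<Rightarrow> int) \<Rightarrow> bool" where
  "regular r n a \<longleftrightarrow>
     (\<forall>C. coloring r C \<longrightarrow> (\<exists>x. monochromatic_solution C n a x))"

end

theory Submission
  imports Defs "HOL-Number_Theory.Cong"
begin

text \<open>The coloring of \<open>x\<close> by the 2-adic valuation modulo \<open>n\<close> has no monochromatic solution: the
  terms of the sum would have pairwise distinct 2-adic valuations.

  Conversely, in an \<open>(n - 1)\<close>-coloring two of \<open>1, 2, \<dots>, 2 ^ (n - 1)\<close>, say \<open>2 ^ k\<close> and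
  \<open>2 ^ (k + d)\<close>, have the same color, and this yields a monochromatic solution of the partial
  equation on a set \<open>T\<close> of indices: \<open>2 ^ d - 2 ^ d = 0\<close> if \<open>d\<close> is odd, and
  \<open>2 ^ d - 2 * 2 ^ d + 2 ^ d = 0\<close> if \<open>d\<close> is even. By van der Waerden's theorem for the coloring
  \<open>x \<mapsto> (C (q * x))\<^sub>q\<close>, there is such a partial solution whose entries may be shifted by multiples
  of some \<open>\<delta>\<close> without changing their color \<open>c\<close>. If a suitable multiple of \<open>\<delta>\<close> has color \<open>c\<close>, it
  can be used for all indices outside \<open>T\<close> and compensated by a shift. Otherwise the
  multiples of \<open>2 ^ n * \<delta>\<close> avoid \<open>c\<close> on a long interval, and one inducts on the number of colors.\<close>

section \<open>Van der Waerden's theorem\<close>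

text \<open>Finitary form: bounding both \<open>a\<close> and \<open>d\<close> by \<open>W\<close>
  is what lets later thresholds be fixed before the coloring. The color type is arbitrary because
  the colors will also be functions.\<close>

definition vdW :: "nat \<Rightarrow> 'b set \<Rightarrow> nat \<Rightarrow> bool" where
  "vdW k F W \<longleftrightarrow> (\<forall>C. range C \<subseteq> F \<longrightarrow>
     (\<exists>a d. 0 < d \<and> d \<le> W \<and> a \<le> W \<and> (\<forall>j<k. C (a + j * d) = C a)))"

text \<open>A bijection renames the colors. The induction on \<open>k\<close> can thus run over sets
  of numbers and still be applied to colorings of blocks.\<close>

lemma vdW_transfer:
  assumes nat: "\<And>r. \<exists>W. vdW k {..<r::nat} W" and F: "finite F"
  shows "\<exists>W. vdW k F W"
proof -
  obtain g where g: "bij_betw g F {..<card F}"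
    using ex_bij_betw_finite_nat[OF F] by (auto simp: atLeast0LessThan)
  obtain W where W: "vdW k {..<card F} W" using nat by blast
  have "vdW k F W"
    unfolding vdW_def
  proof (intro allI impI)
    fix C :: "nat \<Rightarrow> 'a" assume C: "range C \<subseteq> F"
    have "range (g \<circ> C) \<subseteq> {..<card F}"
      using g C by (auto simp: bij_betw_def)
    from W[unfolded vdW_def, rule_format, OF this] obtain a d where "0 < d" "d \<le> W" "a \<le> W"
      and *: "\<And>j. j < k \<Longrightarrow> g (C (a + j * d)) = g (C a)"
      by auto
    moreover have "C (a + j * d) = C a" if "j < k" for j
      using inj_onD[OF bij_betw_imp_inj_on[OF g] *[OF that]] range_subsetD[OF C] by blast
    ultimately show "\<exists>a d. 0 < d \<and> d \<le> W \<and> a \<le> W \<and> (\<forall>j<k. C (a + j * d) = C a)"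
      by blast
  qed
  then show ?thesis ..
qed

text \<open>The notion behind color focusing: whichever color in \<open>S\<close> the common next
  term \<open>f\<close> takes, one of the progressions grows to \<open>k + 1\<close> terms.\<close>

definition focused :: "nat \<Rightarrow> nat \<Rightarrow> (nat \<Rightarrow> nat) \<Rightarrow> nat \<Rightarrow> nat set \<Rightarrow> bool" where
  "focused k w C f S \<longleftrightarrow> f < w \<and>
     (\<forall>c\<in>S. \<exists>a d. 0 < d \<and> d \<le> w \<and> a + k * d = f \<and> (\<forall>j<k. C (a + j * d) = c))"

text \<open>Induction on the number \<open>s\<close> of focused colors. Once all \<open>r\<close>
  colors are focused, no new one is left for the focus.\<close>

lemma color_focusing:
  assumes vdW: "\<And>F :: (nat \<Rightarrow> nat) set. finite F \<Longrightarrow> \<exists>W. vdW k F W"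
  shows "\<exists>w. \<forall>C. range C \<subseteq> {..<r} \<longrightarrow>
    (\<exists>a d. 0 < d \<and> d \<le> w \<and> a \<le> w \<and> (\<forall>j<Suc k. C (a + j * d) = C a)) \<or>
    (\<exists>f S. S \<subseteq> {..<r} \<and> card S = s \<and> focused k w C f S)"
proof (induction s)
  case 0
  show ?case
    by (rule exI[of _ 1]) (auto simp: focused_def intro!: exI[of _ "{}"])
next
  case (Suc s)
  then obtain w where w: "\<And>C. range C \<subseteq> {..<r} \<Longrightarrow>
    (\<exists>a d. 0 < d \<and> d \<le> w \<and> a \<le> w \<and> (\<forall>j<Suc k. C (a + j * d) = C a)) \<or>
    (\<exists>f S. S \<subseteq> {..<r} \<and> card S = s \<and> focused k w C f S)" by blast
  \<comment> \<open>A block of length \<open>w\<close> has its whole color pattern as its color;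
    there are finitely many patterns.\<close>
  obtain V where V: "vdW k (PiE {..<w} (\<lambda>_. {..<r})) V"
    using vdW[of "PiE {..<w} (\<lambda>_. {..<r})"] by (auto intro: finite_PiE)
  \<comment> \<open>The first summand exceeds the new focus; \<open>w + V * w\<close> bounds the new
    differences \<open>d + D * w\<close>.\<close>
  define w' where "w' = (V + k * V + 1) * w + w + V * w"
  show ?case
  proof (rule exI[of _ w'], intro allI impI)
    fix C :: "nat \<Rightarrow> nat" assume C: "range C \<subseteq> {..<r}"
    define B where "B b = (\<lambda>t\<in>{..<w}. C (b * w + t))" for b
    have "range B \<subseteq> PiE {..<w} (\<lambda>_. {..<r})"
      using range_subsetD[OF C] by (auto simp: B_def PiE_iff split: if_splits)
    then obtain b D where D: "0 < D" "D \<le> V" and b: "b \<le> V"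
      and bD: "\<And>j. j < k \<Longrightarrow> B (b + j * D) = B b"
      using V unfolding vdW_def by blast
    have block: "C ((b + j * D) * w + t) = C (b * w + t)" if "j < k" "t < w" for j t
      using fun_cong[OF bD[OF that(1)], of t] that(2) by (simp add: B_def)
    have "b * w \<le> V * w" "D * w \<le> V * w"
      using b D by auto
    then have bounds: "b * w + w \<le> w'" "w + D * w \<le> w'"
      unfolding w'_def add_mult_distrib by linarith+
    let ?mono = "\<exists>a d. 0 < d \<and> d \<le> w' \<and> a \<le> w' \<and> (\<forall>j<Suc k. C (a + j * d) = C a)"
    have shift_mono: ?mono
      if "0 < d" "d \<le> w" "a \<le> w" "\<forall>j<Suc k. C (b * w + (a + j * d)) = C (b * w + a)" for a d
      by (rule exI[of _ "b * w + a"], rule exI[of _ d]) (use that bounds in \<open>simp add: add.assoc\<close>)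
    have "range (\<lambda>t. C (b * w + t)) \<subseteq> {..<r}" using C by auto
    from w[OF this] consider
        (mono) a d where "0 < d" "d \<le> w" "a \<le> w"
          "\<forall>j<Suc k. C (b * w + (a + j * d)) = C (b * w + a)"
      | (focus) f S where "S \<subseteq> {..<r}" "card S = s" "focused k w (\<lambda>t. C (b * w + t)) f S"
      by blast
    then show "?mono \<or> (\<exists>f S. S \<subseteq> {..<r} \<and> card S = Suc s \<and> focused k w' C f S)"
    proof cases
      case mono
      then show ?thesis using shift_mono by blast
    next
      case focus
      have f: "f < w" using focus(3) by (simp add: focused_def)
      show ?thesis
      proof (cases "C (b * w + f) \<in> S")
        case True
        then obtain a d where ad: "0 < d" "d \<le> w" "a + k * d = f"
          and col: "\<forall>j<k. C (b * w + (a + j * d)) = C (b * w + f)"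
          using focus(3) unfolding focused_def by blast
        have "\<forall>j<Suc k. C (b * w + (a + j * d)) = C (b * w + f)"
          using col ad(3) by (auto simp: less_Suc_eq)
        moreover from this have "C (b * w + a) = C (b * w + f)"
          by (metis add_0_right mult_0 zero_less_Suc)
        ultimately have ?mono
          using ad f by (intro shift_mono[of d a]) auto
        then show ?thesis ..
      next
        case False
        \<comment> \<open>The focus has a new color, so pass to its copy \<open>k\<close> block
          steps further on. The copies of \<open>f\<close> in the \<open>k\<close> equal blocks form
          the progression for that color.\<close>
        define f' where "f' = (b + k * D) * w + f"
        have "(b + k * D) * w \<le> (V + k * V) * w"
          using b D by (intro mult_right_mono add_mono mult_left_mono) auto
        then have f': "f' < w'"
          using f by (simp add: f'_def w'_def algebra_simps)
        have new: "\<exists>a d. 0 < d \<and> d \<le> w' \<and> a + k * d = f' \<and> (\<forall>j<k. C (a + j * d) = C (b * w + f))"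
        proof (rule exI[of _ "b * w + f"], rule exI[of _ "D * w"], intro conjI allI impI)
          show "0 < D * w" using D f by simp
          show "D * w \<le> w'" using bounds by linarith
          show "b * w + f + k * (D * w) = f'" by (simp add: f'_def algebra_simps)
          show "C (b * w + f + j * (D * w)) = C (b * w + f)" if "j < k" for j
            using block[OF that f] by (simp add: algebra_simps)
        qed
        have old: "\<exists>a d. 0 < d \<and> d \<le> w' \<and> a + k * d = f' \<and> (\<forall>j<k. C (a + j * d) = c)"
          if c: "c \<in> S" for c
        proof -
          obtain a d where ad: "0 < d" "d \<le> w" "a + k * d = f"
            and col: "\<And>j. j < k \<Longrightarrow> C (b * w + (a + j * d)) = c"
            using focus(3) c unfolding focused_def by blast
          \<comment> \<open>Taking the \<open>j\<close>-th term from the \<open>j\<close>-th equal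
            block adds \<open>D * w\<close> to the old difference and keeps the color.\<close>
          have "C ((b * w + a) + j * (d + D * w)) = c" if j: "j < k" for j
          proof -
            have "j * d \<le> k * d" using j by simp
            then have "a + j * d < w" using ad(3) f by linarith
            then show ?thesis
              using block[OF j, of "a + j * d"] col[OF j] by (simp add: algebra_simps)
          qed
          moreover have "b * w + a + k * (d + D * w) = f'"
            unfolding f'_def ad(3)[symmetric] by (simp add: algebra_simps)
          moreover have "0 < d + D * w" "d + D * w \<le> w'"
            using ad(1,2) bounds by linarith+
          ultimately show ?thesis by blast
        qed
        have "focused k w' C f' (insert (C (b * w + f)) S)"
          unfolding focused_def using f' new old by blast
        moreover have "card (insert (C (b * w + f)) S) = Suc s"
          using False focus(1,2) finite_subset[OF focus(1)] by simp
        moreover have "insert (C (b * w + f)) S \<subseteq> {..<r}"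
          using focus(1) C by auto
        ultimately show ?thesis by blast
      qed
    qed
  qed
qed

theorem van_der_Waerden:
  assumes "finite F"
  shows "\<exists>W. vdW k F W"
proof -
  have "\<exists>W. vdW k {..<r::nat} W" for r
  proof (induction k arbitrary: r)
    case 0
    show ?case by (auto simp: vdW_def intro!: exI[of _ 1])
  next
    case (Suc k)
    have "\<exists>W. vdW k F W" if "finite F" for F :: "(nat \<Rightarrow> nat) set"
      using vdW_transfer[OF Suc that] .
    from color_focusing[OF this, of r "Suc r"] obtain w where w: "\<And>C. range C \<subseteq> {..<r} \<Longrightarrow>
      (\<exists>a d. 0 < d \<and> d \<le> w \<and> a \<le> w \<and> (\<forall>j<Suc k. C (a + j * d) = C a)) \<or>
      (\<exists>f S. S \<subseteq> {..<r} \<and> card S = Suc r \<and> focused k w C f S)" by blast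
    \<comment> \<open>Only \<open>r\<close> colors exist, so \<open>Suc r\<close> of them cannot be
      focused and the progression must occur.\<close>
    have "card S \<noteq> Suc r" if "S \<subseteq> {..<r}" for S
      using card_mono[OF _ that] by simp
    then have "\<exists>a d. 0 < d \<and> d \<le> w \<and> a \<le> w \<and> (\<forall>j<Suc k. C (a + j * d) = C a)"
      if "range C \<subseteq> {..<r}" for C
      using w[OF that] by meson
    then have "vdW (Suc k) {..<r} w" by (simp only: vdW_def) simp
    then show ?case ..
  qed
  then show ?thesis using vdW_transfer assms by blast
qed

section \<open>Regularity\<close>

lemma partial_solution:
  assumes C: "range C \<subseteq> G" and G: "finite G" "card G < n"
  obtains T l and q :: "nat \<Rightarrow> nat" where
    "T \<subseteq> {1..n}" "1 \<in> T" "q 1 = 2 ^ l" "l < n"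
    "\<And>i. i \<in> T \<Longrightarrow> C (q i) = C (2 ^ l)" "\<And>i. i \<in> T \<Longrightarrow> 0 < q i \<and> q i < 2 ^ n"
    "(\<Sum>i\<in>T. (-2) ^ (i - 1) * int (q i)) = 0"
proof -
  have "\<not> inj_on (\<lambda>k. C (2 ^ k)) {..<n}"
  proof
    assume "inj_on (\<lambda>k. C (2 ^ k)) {..<n}"
    then have "card ((\<lambda>k. C (2 ^ k)) ` {..<n}) = n" by (simp add: card_image)
    moreover have "card ((\<lambda>k. C (2 ^ k)) ` {..<n}) \<le> card G"
      using C G(1) by (intro card_mono) auto
    ultimately show False using G(2) by simp
  qed
  then obtain k l where kl: "k < l" "l < n" "C (2 ^ k) = C (2 ^ l)"
    unfolding inj_on_def by (metis lessThan_iff nat_neq_iff)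
  define d where "d = l - k"
  have d: "0 < d" "l = k + d" using kl by (auto simp: d_def)
  \<comment> \<open>Index \<open>Suc d\<close> has coefficient \<open>(-2) ^ d\<close>, so the entry
    \<open>2 ^ k\<close> there contributes \<open>2 ^ l\<close> up to the sign given by the parity
    of \<open>d\<close>.\<close>
  define q :: "nat \<Rightarrow> nat" where "q i = (if i = Suc d then 2 ^ k else 2 ^ l)" for i
  define T where "T = (if odd d then {1, Suc d} else {1, 2, Suc d})"
  have "(\<Sum>i\<in>T. (-2) ^ (i - 1) * int (q i)) = 0"
  proof (cases "odd d")
    case True
    then show ?thesis using d by (simp add: T_def q_def power_add)
  next
    case False
    then have "d \<noteq> 1" by auto
    with False show ?thesis using d by (simp add: T_def q_def power_add)
  qed
  moreover have "T \<subseteq> {1..n}" using kl d by (auto simp: T_def)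
  ultimately show ?thesis
    using that[of T q l] kl d by (auto simp: q_def T_def)
qed

text \<open>A crude geometric bound, uniform in \<open>S\<close>, so that the length of the
  progression can be chosen before \<open>T\<close> is known.\<close>

lemma alternating_sum_bound:
  assumes "S \<subseteq> {1..n}"
  shows "\<bar>\<Sum>i\<in>S. (-2::int) ^ (i - 1)\<bar> \<le> 2 ^ n"
proof -
  have "\<bar>\<Sum>i\<in>S. (-2::int) ^ (i - 1)\<bar> \<le> (\<Sum>i\<in>S. \<bar>(-2::int) ^ (i - 1)\<bar>)"
    by (rule sum_abs)
  also have "\<dots> = (\<Sum>i\<in>S. 2 ^ (i - 1))" by (simp add: power_abs)
  also have "\<dots> \<le> (\<Sum>i\<in>{1..n}. 2 ^ (i - 1))"
    using assms by (intro sum_mono2) auto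
  also have "\<dots> \<le> 2 ^ n"
    by (induction n) auto
  finally show ?thesis .
qed

lemma monochromatic_solution_scale:
  assumes "monochromatic_solution (\<lambda>m. C (M * m)) n a x" "0 < M"
  shows "monochromatic_solution C n a (\<lambda>i. M * x i)"
proof -
  have "(\<Sum>i=1..n. a i * int (M * x i)) = int M * (\<Sum>i=1..n. a i * int (x i))"
    by (simp add: sum_distrib_left mult_ac)
  moreover have "(\<Sum>i=1..n. a i * int (x i)) = 0"
    using assms(1) unfolding monochromatic_solution_def by blast
  ultimately have "(\<Sum>i=1..n. a i * int (M * x i)) = 0" by (simp only: mult_zero_right)
  moreover have "M * x i \<ge> 1" if "i \<in> {1..n}" for i
    using assms that unfolding monochromatic_solution_def by (metis One_nat_def Suc_le_eq nat_0_less_mult_iff)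
  ultimately show ?thesis
    using assms(1) unfolding monochromatic_solution_def by blast
qed

text \<open>The entry with index 1 absorbs the contribution of the indices outside \<open>T\<close>.\<close>

lemma extend_partial_solution:
  assumes T: "T \<subseteq> {1..n}" "1 \<in> T" and q1: "q 1 = 2 ^ l" "l \<le> n"
    and q: "\<And>i. i \<in> T \<Longrightarrow> 0 < q i"
    and sum0: "(\<Sum>i\<in>T. (-2) ^ (i - 1) * int (q i)) = 0"
    and col: "\<And>i z. i \<in> T \<Longrightarrow> \<bar>z\<bar> \<le> 2 ^ n * 2 ^ n * int m \<Longrightarrow>
      0 < int A + z * int \<delta> \<and> C (q i * nat (int A + z * int \<delta>)) = c"
    and m: "0 < m" "0 < \<delta>" "C (2 ^ n * \<delta> * m) = c"
  shows "\<exists>x. monochromatic_solution C n (\<lambda>i. (-2) ^ (i - 1)) x"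
proof -
  define s where "s = (\<Sum>i\<in>{1..n} - T. (-2::int) ^ (i - 1))"
  \<comment> \<open>The indices outside \<open>T\<close> contribute
    \<open>2 ^ n * \<delta> * m * s\<close>; shifting index 1, whose coefficient is 1, contributes
    \<open>2 ^ l * z * \<delta>\<close>. The factor \<open>2 ^ n\<close> makes the quotient an
    integer.\<close>
  define z where "z = - (2 ^ (n - l) * int m * s)"
  have fin: "finite T" using T(1) finite_subset by blast
  have "\<bar>s\<bar> \<le> 2 ^ n" unfolding s_def by (rule alternating_sum_bound) auto
  moreover have "(2::int) ^ (n - l) \<le> 2 ^ n" by simp
  ultimately have "2 ^ (n - l) * \<bar>s\<bar> * int m \<le> 2 ^ n * 2 ^ n * int m"
    by (intro mult_right_mono mult_mono) auto
  then have z: "\<bar>z\<bar> \<le> 2 ^ n * 2 ^ n * int m"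
    by (simp add: z_def abs_mult mult_ac)
  define x where "x i = (if i \<in> T then q i * nat (int A + (if i = 1 then z else 0) * int \<delta>)
    else 2 ^ n * \<delta> * m)" for i
  have pos: "1 \<le> x i" if "i \<in> {1..n}" for i
    using col[of i z] col[of i 0] z q[of i] m by (auto simp: x_def Suc_le_eq)
  have cx: "C (x i) = c" if "i \<in> {1..n}" for i
    using col[of i z] col[of i 0] z m by (auto simp: x_def)
  have xT: "int (x i) = int (q i) * int A + (if i = 1 then 2 ^ l * z * int \<delta> else 0)"
    if "i \<in> T" for i
    using that col[of i z] z q1 by (auto simp: x_def algebra_simps)
  have "(\<Sum>i\<in>T. (-2) ^ (i - 1) * int (x i)) =
      (\<Sum>i\<in>T. (-2) ^ (i - 1) * int (q i) * int A + (if i = 1 then 2 ^ l * z * int \<delta> else 0))"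
    by (intro sum.cong) (auto simp: xT algebra_simps)
  also have "\<dots> = (\<Sum>i\<in>T. (-2) ^ (i - 1) * int (q i)) * int A + 2 ^ l * z * int \<delta>"
    using fin T(2) by (simp add: sum.distrib sum_distrib_right)
  also have "\<dots> = 2 ^ l * z * int \<delta>" using sum0 by simp
  also have "\<dots> = - (2 ^ (l + (n - l)) * int \<delta> * int m * s)"
    by (simp add: z_def power_add mult_ac)
  also have "\<dots> = - (2 ^ n * int \<delta> * int m * s)" using q1(2) by simp
  finally have inT: "(\<Sum>i\<in>T. (-2) ^ (i - 1) * int (x i)) = - (2 ^ n * int \<delta> * int m * s)" .
  have outT: "(\<Sum>i\<in>{1..n} - T. (-2) ^ (i - 1) * int (x i)) = 2 ^ n * int \<delta> * int m * s"
    by (simp add: s_def x_def sum_distrib_left mult_ac)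
  have "(\<Sum>i=1..n. (-2) ^ (i - 1) * int (x i)) = 0"
    using sum.subset_diff[OF T(1), of "\<lambda>i. (-2) ^ (i - 1) * int (x i)"] inT outT by simp
  then have "monochromatic_solution C n (\<lambda>i. (-2) ^ (i - 1)) x"
    unfolding monochromatic_solution_def using pos cx by auto
  then show ?thesis by blast
qed

text \<open>The palette \<open>G\<close> stays fixed, which keeps partial solutions available, while
  the induction counts only the colors seen on an initial segment.\<close>

lemma regular_step:
  fixes G :: "nat set"
  assumes G: "finite G" "card G < n"
    and IH: "\<And>C. range C \<subseteq> G \<Longrightarrow> card (C ` {1..N}) \<le> r \<Longrightarrow>
      \<exists>x. monochromatic_solution C n (\<lambda>i. (-2) ^ (i - 1)) x"
  shows "\<exists>N'. \<forall>C. range C \<subseteq> G \<longrightarrow> card (C ` {1..N'}) \<le> Suc r \<longrightarrow>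
      (\<exists>x. monochromatic_solution C n (\<lambda>i. (-2) ^ (i - 1)) x)"
proof -
  \<comment> \<open>Shifts up to \<open>2 ^ n * 2 ^ n * m\<close> with \<open>m \<le> N\<close> stay
    strictly below \<open>J\<close> in absolute value.\<close>
  define J :: nat where "J = 2 ^ n * 2 ^ n * N + 1"
  obtain W where W: "vdW (2 * J + 1) (PiE {..<2 ^ n :: nat} (\<lambda>_. G)) W"
    using van_der_Waerden[of "PiE {..<2 ^ n :: nat} (\<lambda>_. G)"] G by (auto intro: finite_PiE)
  \<comment> \<open>The summands bound the multiples \<open>2 ^ n * \<delta> * m\<close> and the
    point \<open>2 ^ l * A\<close> of color \<open>c\<close>, respectively.\<close>
  define N' where "N' = 2 ^ n * W * N + 2 ^ n * (W + J * W)"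
  show ?thesis
  proof (rule exI[of _ N'], intro allI impI)
    fix C assume C: "range C \<subseteq> G" and cardC: "card (C ` {1..N'}) \<le> Suc r"
    \<comment> \<open>Recording all colors \<open>C (q * x)\<close> at once yields one progression
      that serves every multiplier \<open>q < 2 ^ n\<close>.\<close>
    define P where "P x = (\<lambda>q\<in>{..<2 ^ n}. C (q * x))" for x
    have "range P \<subseteq> PiE {..<2 ^ n} (\<lambda>_. G)" using range_subsetD[OF C] by (auto simp: P_def PiE_iff split: if_splits)
    then obtain a \<delta> where \<delta>: "0 < \<delta>" "\<delta> \<le> W" and a: "a \<le> W"
      and P: "\<And>j. j < 2 * J + 1 \<Longrightarrow> P (a + j * \<delta>) = P a"
      using W unfolding vdW_def by blast
    have prog: "C (q * (a + j * \<delta>)) = C (q * a)" if "j < 2 * J + 1" "q < 2 ^ n" for j q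
      using fun_cong[OF P[OF that(1)], of q] that(2) by (simp add: P_def)
    \<comment> \<open>The middle term, leaving room for shifts of both signs.\<close>
    define A where "A = a + J * \<delta>"
    have shift: "0 < int A + z * int \<delta> \<and> C (q * nat (int A + z * int \<delta>)) = C (q * A)"
      if z: "\<bar>z\<bar> < int J" and q: "q < 2 ^ n" for q z
    proof -
      \<comment> \<open>Strictness of \<open>\<bar>z\<bar> < int J\<close> gives
        \<open>0 < j\<close>, so the shifted term is positive even if \<open>a = 0\<close>.\<close>
      define j where "j = nat (int J + z)"
      have j: "0 < j" "j < 2 * J + 1" "int A + z * int \<delta> = int (a + j * \<delta>)"
        using z by (auto simp: j_def A_def algebra_simps)
      have "0 < a + j * \<delta>" using j(1) \<delta>(1) by simp
      moreover have "C (q * (a + j * \<delta>)) = C (q * A)"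
        using prog[OF j(2) q] prog[of J q] q by (simp add: A_def)
      ultimately show ?thesis unfolding j(3) nat_int of_nat_0_less_iff ..
    qed
    have CA: "range (\<lambda>q. C (q * A)) \<subseteq> G" using C by auto
    obtain T l q where
      T: "T \<subseteq> {1..n}" "1 \<in> T" and q1: "q 1 = 2 ^ l" "l < n"
      and cq: "\<And>i. i \<in> T \<Longrightarrow> C (q i * A) = C (2 ^ l * A)"
      and q: "\<And>i. i \<in> T \<Longrightarrow> 0 < q i \<and> q i < 2 ^ n"
      and sum0: "(\<Sum>i\<in>T. (-2) ^ (i - 1) * int (q i)) = 0"
      by (rule partial_solution[OF CA G]) (rule that)
    define c where "c = C (2 ^ l * A)"
    show "\<exists>x. monochromatic_solution C n (\<lambda>i. (-2) ^ (i - 1)) x"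
    proof (cases "\<exists>m\<in>{1..N}. C (2 ^ n * \<delta> * m) = c")
      case True
      then obtain m where m: "0 < m" "m \<le> N" "C (2 ^ n * \<delta> * m) = c"
        by (auto simp: Suc_le_eq)
      have "\<bar>z\<bar> < int J" if "\<bar>z\<bar> \<le> 2 ^ n * 2 ^ n * int m" for z
      proof -
        have "2 ^ n * 2 ^ n * int m \<le> 2 ^ n * 2 ^ n * int N" using m(2) by simp
        then have "2 ^ n * 2 ^ n * int m < int J" by (simp only: J_def of_nat_add of_nat_mult) simp
        then show ?thesis using that by linarith
      qed
      then show ?thesis
        using shift q cq m \<delta> q1
        by (intro extend_partial_solution[OF T q1(1) _ _ sum0, where c = c and m = m and A = A and \<delta> = \<delta>])
           (auto simp: c_def)
    next
      case False
      have "A \<le> W + J * W" using a \<delta> by (auto simp: A_def intro: add_mono)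
      moreover have "(2::nat) ^ l \<le> 2 ^ n" using q1 by simp
      ultimately have "2 ^ l * A \<le> 2 ^ n * (W + J * W)" by (intro mult_mono) auto
      then have "2 ^ l * A \<le> N'" unfolding N'_def by linarith
      moreover have "0 < 2 ^ l * A" using \<delta> by (simp add: A_def J_def)
      ultimately have c: "c \<in> C ` {1..N'}" by (auto simp: c_def)
      have "2 ^ n * \<delta> * m \<in> {1..N'}" if "m \<in> {1..N}" for m
      proof -
        have "2 ^ n * \<delta> * m \<le> 2 ^ n * W * N"
          using that \<delta> by (intro mult_mono) auto
        moreover have "0 < 2 ^ n * \<delta> * m" using that \<delta> by auto
        ultimately show ?thesis unfolding N'_def atLeastAtMost_iff by linarith
      qed
      \<comment> \<open>The color \<open>c\<close> occurs on \<open>{1..N'}\<close> but not on these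
        multiples, so the dilated coloring has lost a color and the induction hypothesis
        applies.\<close>
      then have "(\<lambda>m. C (2 ^ n * \<delta> * m)) ` {1..N} \<subseteq> C ` {1..N'} - {c}"
        using False by blast
      from card_mono[OF _ this] have "card ((\<lambda>m. C (2 ^ n * \<delta> * m)) ` {1..N}) \<le> r"
        using c cardC by simp
      then obtain x where
        "monochromatic_solution (\<lambda>m. C (2 ^ n * \<delta> * m)) n (\<lambda>i. (-2) ^ (i - 1)) x"
        using IH[of "\<lambda>m. C (2 ^ n * \<delta> * m)"] C by auto
      from monochromatic_solution_scale[OF this] show ?thesis using \<delta>(1) by auto
    qed
  qed
qed

lemma regular_alternating_powers_of_two:
  assumes "r < n"
  shows "regular r n (\<lambda>i. (-2) ^ (i - 1))"
proof -
  have bounded: "\<exists>N. \<forall>C. range C \<subseteq> {1..r} \<longrightarrow> card (C ` {1..N}) \<le> t \<longrightarrow>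
      (\<exists>x. monochromatic_solution C n (\<lambda>i. (-2) ^ (i - 1)) x)" for t
  proof (induction t)
    case 0
    \<comment> \<open>The segment \<open>{1..1}\<close> is nonempty, so it cannot carry zero
      colors.\<close>
    show ?case by (rule exI[of _ 1]) auto
  next
    case (Suc t)
    then obtain N where N: "\<And>C. range C \<subseteq> {1..r} \<Longrightarrow> card (C ` {1..N}) \<le> t \<Longrightarrow>
      \<exists>x. monochromatic_solution C n (\<lambda>i. (-2) ^ (i - 1)) x" by blast
    have "finite {1..r}" "card {1..r} < n" using assms by auto
    from regular_step[OF this N] show ?case .
  qed
  show ?thesis
    unfolding regular_def
  proof (intro allI impI)
    fix C assume C: "coloring r C"
    \<comment> \<open>\<open>C 0\<close> is unconstrained, whereas the induction needs every value
      in \<open>{1..r}\<close>.\<close>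
    define C' where "C' x = C (max 1 x)" for x
    have ran: "range C' \<subseteq> {1..r}"
      using C funcset_mem[of C "{1..}" "{1..r}" "max 1 _"] unfolding coloring_def C'_def by auto
    obtain N where N: "\<forall>C. range C \<subseteq> {1..r} \<longrightarrow> card (C ` {1..N}) \<le> r \<longrightarrow>
      (\<exists>x. monochromatic_solution C n (\<lambda>i. (-2) ^ (i - 1)) x)" using bounded by blast
    have "card (C' ` {1..N}) \<le> r"
      using card_mono[of "{1..r}" "C' ` {1..N}"] ran by auto
    then obtain x where "monochromatic_solution C' n (\<lambda>i. (-2) ^ (i - 1)) x"
      using N ran by blast
    moreover from this have "C' (x i) = C (x i)" if "i \<in> {1..n}" for i
      using that unfolding monochromatic_solution_def C'_def by (metis max.absorb2)
    ultimately have "monochromatic_solution C n (\<lambda>i. (-2) ^ (i - 1)) x"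
      unfolding monochromatic_solution_def by metis
    then show "\<exists>x. monochromatic_solution C n (\<lambda>i. (-2) ^ (i - 1)) x" by blast
  qed
qed

section \<open>Failure of \<open>n\<close>-regularity by 2-adic valuations\<close>

lemma sum_distinct_valuations_nonzero:
  fixes f :: "'a \<Rightarrow> int"
  assumes "finite S" "S \<noteq> {}" "inj_on v S"
    and f: "\<And>i. i \<in> S \<Longrightarrow> \<exists>u. odd u \<and> f i = 2 ^ v i * u"
  shows "sum f S \<noteq> 0"
proof
  assume zero: "sum f S = 0"
  \<comment> \<open>For the least exponent \<open>v i\<close>, every other term is divisible by
    \<open>2 ^ Suc (v i)\<close>, but \<open>f i\<close> is not.\<close>
  obtain i where i: "i \<in> S" "\<And>j. j \<in> S \<Longrightarrow> v i \<le> v j"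
    using ex_min_if_finite[of "v ` S"] assms(1,2) by (force simp: not_less)
  have "2 ^ Suc (v i) dvd f j" if "j \<in> S - {i}" for j
  proof -
    have "v j \<noteq> v i" using that i(1) assms(3) by (auto dest: inj_onD)
    then have "Suc (v i) \<le> v j" using i(2)[of j] that by simp
    then have "(2::int) ^ Suc (v i) dvd 2 ^ v j" by (rule le_imp_power_dvd)
    then show ?thesis using f[of j] that by auto
  qed
  then have "2 ^ Suc (v i) dvd sum f (S - {i})" by (rule dvd_sum)
  moreover have "f i = - sum f (S - {i})"
    using zero sum.remove[OF assms(1) i(1), of f] by simp
  ultimately have "2 ^ Suc (v i) dvd f i" by simp
  moreover obtain u where "odd u" "f i = 2 ^ v i * u" using f i(1) by blast
  ultimately show False by simp
qed

lemma not_regular_alternating_powers_of_two: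
  assumes "0 < n"
  shows "\<not> regular n n (\<lambda>i. (-2) ^ (i - 1))"
proof
  assume reg: "regular n n (\<lambda>i. (-2) ^ (i - 1))"
  have "\<exists>v u. odd u \<and> x = 2 ^ v * u" if "0 < x" for x :: nat
    using that
  proof (induction x rule: less_induct)
    case (less x)
    show ?case
    proof (cases "odd x")
      case True
      then show ?thesis by (intro exI[of _ 0] exI[of _ x]) simp
    next
      case False
      then obtain y where y: "x = 2 * y" by blast
      then have "y < x" "0 < y" using less.prems by auto
      then obtain v u where "odd u" "y = 2 ^ v * u" using less.IH by blast
      then show ?thesis using y by (intro exI[of _ "Suc v"] exI[of _ u]) simp
    qed
  qed
  then obtain v u where vu: "\<And>x::nat. 0 < x \<Longrightarrow> odd (u x) \<and> x = 2 ^ v x * u x"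
    by metis
  define C where "C x = Suc (v x mod n)" for x
  have "coloring n C" using assms by (auto simp: coloring_def C_def Suc_le_eq)
  then obtain x where sol: "monochromatic_solution C n (\<lambda>i. (-2) ^ (i - 1)) x"
    using reg unfolding regular_def by blast
  then have zero: "(\<Sum>i=1..n. (-2) ^ (i - 1) * int (x i)) = 0"
    unfolding monochromatic_solution_def by blast
  have x: "0 < x i" if "i \<in> {1..n}" for i
    using sol that unfolding monochromatic_solution_def by fastforce
  have mono: "v (x i) mod n = v (x j) mod n" if "i \<in> {1..n}" "j \<in> {1..n}" for i j
    using sol that unfolding monochromatic_solution_def C_def by blast
  \<comment> \<open>The valuation of the \<open>i\<close>-th term. As \<open>v (x i)\<close> is
    constant modulo \<open>n\<close>, the residues of \<open>w i\<close> differ because the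
    \<open>i - 1 < n\<close> do.\<close>
  define w where "w i = i - 1 + v (x i)" for i
  have "inj_on w {1..n}"
  proof (rule inj_onI)
    fix i j assume ij: "i \<in> {1..n}" "j \<in> {1..n}" "w i = w j"
    have "(i - 1 + v (x i)) mod n = (j - 1 + v (x i)) mod n"
      using ij(3) mono[OF ij(1,2)] unfolding w_def by (metis mod_add_right_eq)
    then have "(i - 1) mod n = (j - 1) mod n"
      by (simp only: cong_def[symmetric] cong_add_rcancel_nat)
    moreover have "i - 1 < n" "j - 1 < n" using ij by auto
    ultimately show "i = j" using ij by auto
  qed
  moreover have "\<exists>t. odd t \<and> (-2) ^ (i - 1) * int (x i) = 2 ^ w i * t" if "i \<in> {1..n}" for i
  proof -
    have "(-2::int) ^ (i - 1) = (-1) ^ (i - 1) * 2 ^ (i - 1)"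
      by (simp flip: power_mult_distrib)
    moreover have "int (x i) = 2 ^ v (x i) * int (u (x i))"
      using vu[OF x[OF that]] by (metis of_nat_mult of_nat_numeral of_nat_power)
    ultimately have "(-2) ^ (i - 1) * int (x i) = 2 ^ w i * ((-1) ^ (i - 1) * int (u (x i)))"
      by (simp add: w_def power_add)
    moreover have "odd ((-1) ^ (i - 1) * int (u (x i)))"
      using vu[OF x[OF that]] by simp
    ultimately show ?thesis by blast
  qed
  ultimately show False
    using sum_distinct_valuations_nonzero[of "{1..n}" w "\<lambda>i. (-2) ^ (i - 1) * int (x i)"]
      zero assms by auto
qed

theorem theorem3p2:
  fixes n :: nat
  assumes "n \<ge> 2"
  shows "regular (n - 1) n (\<lambda>i. (-2) ^ (i - 1)) \<and>
         \<not> regular n n (\<lambda>i. (-2) ^ (i - 1))"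
  using regular_alternating_powers_of_two not_regular_alternating_powers_of_two assms by simp

end
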